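(* Let $X$ be a real normed space and let $K\subset X$ be a convex body. Then for all $\mathbf{x}\in K$ we have $$\sigma(K,\mathbf{x})=\frac{1}{\omega(K,\mathbf{x})}-1.$$
   Context: $X$ is a real normed space, $X\neq\{0\}$, with unit sphere $S$. A convex body is a bounded, closed, convex set with nonempty interior. For $\mathbf{x}\in X$ let $\mathcal{L}=\mathcal{L}(K,\mathbf{x})$ be the set of straight lines $l=\{\mathbf{x}+t\mathbf{v}:t\in\mathbb{R}\}$, $\mathbf{v}\in S$, that meet $K$ in more than one point; for $l\in\mathcal{L}$ write $K\cap l=[\mathbf{a},\mathbf{b}]$, $\mathbf{a}\neq\mathbf{b}$, with endpoints labelled so that $\|\mathbf{x}-\mathbf{b}\|\le\|\mathbf{x}-\mathbf{a}\|$. Define $$\sigma(K,\mathbf{x})=\inf_{l\in\mathcal{L}}\frac{\|\mathbf{b}-\mathbf{x}\|}{\|\mathbf{a}-\mathbf{x}\|}\quad(\mathbf{x}\in X),\qquad \omega(K,\mathbf{x})=\sup_{l\in\mathcal{L}}\frac{\|\mathbf{a}-\mathbf{x}\|}{\|\mathbf{a}-\mathbf{b}\|}\quad(\mathbf{x}\in K).$$ *)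

theory Defs
  imports "HOL-Analysis.Analysis"
begin

definition convex_body :: "'a::real_normed_vector set \<Rightarrow> bool" where
  "convex_body K \<longleftrightarrow> bounded K \<and> closed K \<and> convex K \<and> interior K \<noteq> {}"

definition line_through :: "'a::real_normed_vector \<Rightarrow> 'a \<Rightarrow> 'a set" where
  "line_through x v = {x + t *\<^sub>R v | t. t \<in> (UNIV :: real set)}"

definition chord_lines :: "'a::real_normed_vector set \<Rightarrow> 'a \<Rightarrow> 'a set set" where
  "chord_lines K x =
     {l. (\<exists>v \<in> sphere 0 1. l = line_through x v) \<and>
         (\<exists>p \<in> K \<inter> l. \<exists>q \<in> K \<inter> l. p \<noteq> q)}"

(* For a convex body K and l in chord_lines K x, the pair (a, b) is unique
   except when a and b are equidistant from x; then both labellings are allowed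
   and, the distances being equal, they give the same quotients below. *)
definition chord_endpoints ::
    "'a::real_normed_vector set \<Rightarrow> 'a \<Rightarrow> 'a set \<Rightarrow> 'a \<Rightarrow> 'a \<Rightarrow> bool" where
  "chord_endpoints K x l a b \<longleftrightarrow>
     K \<inter> l = closed_segment a b \<and> a \<noteq> b \<and> norm (x - b) \<le> norm (x - a)"

(* Inf and Sup are those of the reals. For a convex body K in a nontrivial space
   the sets are nonempty, and they are bounded: the quotients in chord_sigma lie
   in [0,1], and those in chord_omega lie in [1/2,1] when x is in K. Only in the
   latter case is chord_omega meaningful. *)
definition chord_sigma :: "'a::real_normed_vector set \<Rightarrow> 'a \<Rightarrow> real" where
  "chord_sigma K x =
     Inf {norm (b - x) / norm (a - x) | l a b. l \<in> chord_lines K x \<and> chord_endpoints K x l a b}"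

definition chord_omega :: "'a::real_normed_vector set \<Rightarrow> 'a \<Rightarrow> real" where
  "chord_omega K x =
     Sup {norm (a - x) / norm (a - b) | l a b. l \<in> chord_lines K x \<and> chord_endpoints K x l a b}"

end

theory Submission imports Defs begin

text \<open>
  Fix \<open>x \<in> K\<close> and a chord with endpoints \<open>a\<close> and \<open>b\<close>.  Both \<open>x\<close> and the chord lie on one line
  and \<open>x\<close> is in \<open>K\<close>, so \<open>x\<close> lies between \<open>a\<close> and \<open>b\<close> and the distances add up:
  \<open>\<parallel>a - b\<parallel> = \<parallel>a - x\<parallel> + \<parallel>x - b\<parallel>\<close>.  Dividing by \<open>\<parallel>a - x\<parallel>\<close> shows that the chord contributes to
  \<open>\<sigma>\<close> exactly the value \<open>1 / w - 1\<close>, where \<open>w\<close> is its contribution to \<open>\<omega>\<close>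
  (lemma \<open>chord_quotient\<close>).  The map \<open>w \<mapsto> 1 / w - 1\<close> is continuous and decreasing on
  the positive reals, so it turns the supremum into the infimum (lemma \<open>Inf_inverse_minus_one\<close>).
  This needs at least one chord, since \<open>Inf\<close> and \<open>Sup\<close> of the empty set are unspecified reals.
  A body with nonempty interior in a nontrivial space has a point other than \<open>x\<close>
  (lemma \<open>convex_body_other_point\<close>), and by compactness and convexity the line
  through the two points cuts \<open>K\<close> in a segment (lemma \<open>convex_body_Int_line\<close>).
\<close>

lemma Inf_inverse_minus_one:
  fixes W :: "real set"
  assumes "W \<noteq> {}" and "bdd_above W" and pos: "\<And>w. w \<in> W \<Longrightarrow> 0 < w"
  shows "Inf ((\<lambda>w. 1 / w - 1) ` W) = 1 / Sup W - 1"
proof -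
  obtain w0 where w0: "w0 \<in> W" using assms(1) by blast
  have up: "w \<le> Sup W" if "w \<in> W" for w
    using that assms(2) by (rule cSup_upper)
  have Sup_pos: "0 < Sup W" using up[OF w0] pos[OF w0] by linarith
  show ?thesis
  proof (rule cInf_eq_non_empty)
    show "(\<lambda>w. 1 / w - 1) ` W \<noteq> {}" using assms(1) by blast
  next
    fix s assume "s \<in> (\<lambda>w. 1 / w - 1) ` W"
    then obtain w where w: "w \<in> W" "s = 1 / w - 1" by blast
    show "1 / Sup W - 1 \<le> s"
      using up[OF w(1)] pos[OF w(1)] w(2) by (simp add: frac_le)
  next
    fix c assume c: "\<And>s. s \<in> (\<lambda>w. 1 / w - 1) ` W \<Longrightarrow> c \<le> s"
    show "c \<le> 1 / Sup W - 1"
    proof (cases "c + 1 \<le> 0")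
      case True
      have "0 < 1 / Sup W" using Sup_pos by simp
      then show ?thesis using True by linarith
    next
      case False
      have "Sup W \<le> 1 / (c + 1)"
      proof (rule cSup_least[OF assms(1)])
        fix w assume w: "w \<in> W"
        have "c + 1 \<le> 1 / w" using c[of "1 / w - 1"] w by auto
        then show "w \<le> 1 / (c + 1)" using pos[OF w] False by (simp add: field_simps)
      qed
      then have "c + 1 \<le> 1 / Sup W" using Sup_pos False by (simp add: field_simps)
      then show ?thesis by linarith
    qed
  qed
qed

lemma convex_body_other_point:
  fixes K :: "'a::real_normed_vector set"
  assumes "(UNIV :: 'a set) \<noteq> {0}" and "convex_body K"
  obtains y where "y \<in> K" and "y \<noteq> x"
proof -
  obtain z :: 'a where z: "z \<noteq> 0" using assms(1) by auto
  obtain p where "p \<in> interior K" using assms(2) unfolding convex_body_def by blast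
  then obtain e where e: "0 < e" "cball p e \<subseteq> K" by (auto simp: mem_interior_cball)
  let ?q = "p + (e / norm z) *\<^sub>R z"
  have "p \<in> K" "?q \<in> K" using e z by (auto intro!: subsetD[OF e(2)] simp: dist_norm)
  moreover have "?q \<noteq> p" using e z by simp
  ultimately show ?thesis using that by metis
qed

text \<open>
  The parameters \<open>t\<close> with \<open>x + t v \<in> K\<close> form a compact convex set of reals, hence a closed
  interval.  Passing to parameters matters because closed bounded sets need not be compact in \<open>X\<close>,
  whereas in the reals they are.
\<close>

lemma convex_body_Int_line:
  fixes K :: "'a::real_normed_vector set"
  assumes K: "convex_body K" and v: "norm v = 1"
    and ne: "K \<inter> line_through x v \<noteq> {}"
  obtains a b where "K \<inter> line_through x v = closed_segment a b"
proof -
  define T where "T = {t. x + t *\<^sub>R v \<in> K}"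
  have KT: "K \<inter> line_through x v = (\<lambda>t. x + t *\<^sub>R v) ` T"
    unfolding T_def line_through_def by auto
  have T: "T = (\<lambda>t. x + t *\<^sub>R v) -` K" unfolding T_def by auto
  have "closed T" unfolding T
    using K unfolding convex_body_def by (intro continuous_closed_vimage) auto
  moreover have "bounded T"
  proof -
    obtain B where B: "\<And>y. y \<in> K \<Longrightarrow> norm y \<le> B"
      using K unfolding convex_body_def bounded_iff by blast
    have "norm t \<le> B + norm x" if "t \<in> T" for t
    proof -
      have "norm t = norm ((x + t *\<^sub>R v) - x)" using v by simp
      also have "\<dots> \<le> norm (x + t *\<^sub>R v) + norm x" by (rule norm_triangle_ineq4)
      also have "\<dots> \<le> B + norm x" using B that unfolding T_def by auto
      finally show ?thesis .
    qed
    then show ?thesis unfolding bounded_iff by blast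
  qed
  moreover have "convex T"
  proof (rule convexI)
    fix s t u w :: real
    assume h: "s \<in> T" "t \<in> T" "0 \<le> u" "0 \<le> w" "u + w = 1"
    have "u *\<^sub>R (x + s *\<^sub>R v) + w *\<^sub>R (x + t *\<^sub>R v) \<in> K"
      using h K unfolding T_def convex_body_def by (auto intro: convexD)
    also have "u *\<^sub>R (x + s *\<^sub>R v) + w *\<^sub>R (x + t *\<^sub>R v)
        = (u + w) *\<^sub>R x + (u * s + w * t) *\<^sub>R v"
      by (simp add: algebra_simps)
    finally show "u *\<^sub>R s + w *\<^sub>R t \<in> T" using h(5) unfolding T_def by simp
  qed
  ultimately obtain c d where cd: "T = {c..d}"
    by (metis compact_eq_bounded_closed convex_connected connected_compact_interval_1)
  have "T \<noteq> {}" using ne KT by auto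
  then have "T = closed_segment c d" using cd by (simp add: closed_segment_eq_real_ivl)
  moreover have "(\<lambda>t. x + t *\<^sub>R v) ` closed_segment c d
      = closed_segment (x + c *\<^sub>R v) (x + d *\<^sub>R v)"
  proof -
    have "(\<lambda>t. x + t *\<^sub>R v) ` closed_segment c d = (+) x ` (\<lambda>t. t *\<^sub>R v) ` closed_segment c d"
      by (simp add: image_image)
    also have "(\<lambda>t. t *\<^sub>R v) ` closed_segment c d = closed_segment (c *\<^sub>R v) (d *\<^sub>R v)"
      by (rule closed_segment_linear_image[symmetric])
         (intro bounded_linear.linear bounded_linear_scaleR_left)
    finally show ?thesis by (simp add: closed_segment_translation)
  qed
  ultimately show ?thesis using that KT by metis
qed

lemma convex_body_chord_exists:
  fixes K :: "'a::real_normed_vector set"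
  assumes "(UNIV :: 'a set) \<noteq> {0}" and K: "convex_body K" and x: "x \<in> K"
  obtains l a b where "l \<in> chord_lines K x" and "chord_endpoints K x l a b"
proof -
  obtain y where y: "y \<in> K" "y \<noteq> x" using convex_body_other_point[OF assms(1) K] .
  define v where "v = (1 / norm (y - x)) *\<^sub>R (y - x)"
  let ?l = "line_through x v"
  have v: "norm v = 1" using y(2) unfolding v_def by simp
  have "x = x + 0 *\<^sub>R v" by simp
  then have xl: "x \<in> K \<inter> ?l" using x unfolding line_through_def by blast
  have "y = x + norm (y - x) *\<^sub>R v" using y(2) unfolding v_def by simp
  then have yl: "y \<in> K \<inter> ?l" using y(1) unfolding line_through_def by blast
  have l: "?l \<in> chord_lines K x"
  proof -
    have "v \<in> sphere 0 1" using v by simp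
    then show ?thesis unfolding chord_lines_def mem_Collect_eq using xl yl y(2) by metis
  qed
  have "K \<inter> ?l \<noteq> {}" using xl by blast
  then obtain a b where ab: "K \<inter> ?l = closed_segment a b"
    using convex_body_Int_line[OF K v] by blast
  have "a \<noteq> b"
  proof
    assume "a = b"
    then have "K \<inter> ?l = {a}" using ab by simp
    then have "x = a" and "y = a" using xl yl by (metis singletonD)+
    then show False using y(2) by simp
  qed
  then have "chord_endpoints K x ?l a b \<or> chord_endpoints K x ?l b a"
    unfolding chord_endpoints_def using ab closed_segment_commute[of a b]
      linear[of "norm (x - b)" "norm (x - a)"] by metis
  then show ?thesis using that l by blast
qed

text \<open>
  Since \<open>x\<close> lies on the segment \<open>[a, b]\<close>, both \<open>a - x\<close> and \<open>b - x\<close> are multiples of \<open>a - b\<close>.  The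
  distances therefore add up by homogeneity of the norm alone, although in a norm that is not
  strictly convex additivity does not characterise betweenness.
\<close>

lemma chord_quotient:
  assumes "x \<in> K" and l: "l \<in> chord_lines K x" and e: "chord_endpoints K x l a b"
  shows "0 < norm (a - x) / norm (a - b)" and "norm (a - x) / norm (a - b) \<le> 1"
    and "norm (b - x) / norm (a - x) = 1 / (norm (a - x) / norm (a - b)) - 1"
proof -
  obtain v where "l = line_through x v" using l unfolding chord_lines_def by blast
  moreover have "x = x + 0 *\<^sub>R v" by simp
  ultimately have "x \<in> l" unfolding line_through_def by blast
  then have "x \<in> closed_segment a b" using assms(1) e unfolding chord_endpoints_def by blast
  then obtain u where u: "0 \<le> u" "u \<le> 1" and xu: "x = (1 - u) *\<^sub>R a + u *\<^sub>R b"
    unfolding closed_segment_def by blast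
  have "a - x = u *\<^sub>R (a - b)" and "b - x = (u - 1) *\<^sub>R (a - b)"
    unfolding xu by (simp_all add: algebra_simps)
  then have "norm (a - x) = u * norm (a - b)" and "norm (b - x) = (1 - u) * norm (a - b)"
    using u by simp_all
  then have add: "norm (a - b) = norm (a - x) + norm (b - x)"
    by (simp add: algebra_simps)
  have "a \<noteq> b" and le: "norm (b - x) \<le> norm (a - x)"
    using e unfolding chord_endpoints_def by (auto simp: norm_minus_commute)
  \<comment> \<open>The denominator of the quotient in \<open>\<sigma>\<close> cannot vanish: \<open>a\<close> is the endpoint farther from \<open>x\<close>.\<close>
  have "0 < norm (a - b)" using \<open>a \<noteq> b\<close> by simp
  with add le have pos: "0 < norm (a - x)" by linarith
  show "0 < norm (a - x) / norm (a - b)"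
    using pos \<open>0 < norm (a - b)\<close> by (rule divide_pos_pos)
  have "norm (a - x) \<le> norm (a - b)" using add by simp
  then show "norm (a - x) / norm (a - b) \<le> 1"
    using \<open>0 < norm (a - b)\<close> divide_le_eq_1_pos by blast
  show "norm (b - x) / norm (a - x) = 1 / (norm (a - x) / norm (a - b)) - 1"
    using pos add by (simp add: field_simps)
qed

theorem proposition4p6:
  fixes K :: "'a::real_normed_vector set"
  assumes "(UNIV :: 'a set) \<noteq> {0}"
    and "convex_body K"
  shows "\<forall>x \<in> K. chord_sigma K x = 1 / chord_omega K x - 1"
proof
  fix x assume x: "x \<in> K"
  define W where "W = {norm (a - x) / norm (a - b) | l a b.
      l \<in> chord_lines K x \<and> chord_endpoints K x l a b}"
  have "{norm (b - x) / norm (a - x) | l a b. l \<in> chord_lines K x \<and> chord_endpoints K x l a b}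
      = {1 / (norm (a - x) / norm (a - b)) - 1 | l a b.
          l \<in> chord_lines K x \<and> chord_endpoints K x l a b}"
    by (rule Collect_cong) (metis (no_types, lifting) chord_quotient(3)[OF x])
  also have "\<dots> = (\<lambda>w. 1 / w - 1) ` W"
    unfolding W_def by blast
  finally have "chord_sigma K x = Inf ((\<lambda>w. 1 / w - 1) ` W)"
    unfolding chord_sigma_def by simp
  also have "\<dots> = 1 / Sup W - 1"
  proof (rule Inf_inverse_minus_one)
    obtain l a b where "l \<in> chord_lines K x" and "chord_endpoints K x l a b"
      using convex_body_chord_exists[OF assms x] .
    then have "norm (a - x) / norm (a - b) \<in> W" unfolding W_def by blast
    then show "W \<noteq> {}" by blast
    have bounds: "0 < w \<and> w \<le> 1" if w: "w \<in> W" for w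
    proof -
      obtain l a b where w_eq: "w = norm (a - x) / norm (a - b)"
        and ends: "l \<in> chord_lines K x" "chord_endpoints K x l a b"
        using w unfolding W_def by blast
      show ?thesis unfolding w_eq using chord_quotient(1,2)[OF x ends] by (rule conjI)
    qed
    then show "bdd_above W" by (meson bdd_aboveI)
    show "0 < w" if "w \<in> W" for w using bounds[OF that] by (rule conjunct1)
  qed
  finally show "chord_sigma K x = 1 / chord_omega K x - 1"
    unfolding chord_omega_def W_def .
qed

end
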